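(* Let $(S,\Sigma,\mu)$ be a positive measure space, let $X$ be a real Banach space whose norm is Fréchet differentiable, and let $G$ be a (linear, not necessarily closed) subspace of $L^{1}(\mu,X)$. Let $f\in L^{1}(\mu,X)\setminus\overline{G}$ and $g_0\in G$. Then $g_0\in\mathcal{P}_G(f)$ if and only if $$\left|\int_{Z(f-g_0)^c}F_{f(s)-g_0(s)}(g(s))\,d\mu(s)\right|\le\int_{Z(f-g_0)}\|g(s)\|\,d\mu(s)\quad\text{for all } g\in G.$$
   Context: For a positive measure space $(S,\Sigma,\mu)$ and a Banach space $X$, $L^{1}(\mu,X)$ is the Lebesgue-Bochner space of (classes modulo a.e. equality of) strongly measurable functions $f:S\to X$ with $\|f\|_1=\int_S\|f(s)\|\,d\mu(s)<\infty$. The norm of a real Banach space $X$ is Fréchet differentiable if for every $0\neq x\in X$ there is $\varphi\in X^*$ with $\lim_{h\to0}\frac{|\|x+h\|-\|x\|-\varphi(h)|}{\|h\|}=0$. For $0\neq x\in X$, a support map $F_x$ at $x$ is a bounded linear functional on $X$ with $\|F_x\|=1$ and $F_x(x)=\|x\|$; when the norm is Fréchet differentiable, $F_x$ is unique for each $x\neq0$. For a function $h:S\to X$, $Z(h)=\{s\in S: h(s)=0\}$ and $Z(h)^c$ is its complement in $S$. For a subspace $G$ of a normed space $E$ and $f\in E$, $\mathcal{P}_G(f)$ is the set of best approximants of $f$ in $G$, i.e. the set of $g_0\in G$ with $\|f-g_0\|=\inf\{\|f-g\|:g\in G\}$. *)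

theory Defs
  imports "HOL-Analysis.Analysis"
begin

text \<open>
  The Banach space \<open>X\<close> is a type \<open>'b::banach\<close> that need not be separable. The library's
  Bochner integral (predicate \<^const>\<open>integrable\<close>) requires a second countable codomain, so it is
  only applied to real-valued functions here, and the space \<open>L\<^sup>1(\<mu>,X)\<close> is defined from strong
  measurability. Its elements are represented by functions, and \<open>L1_norm\<close> is a seminorm on these.
  Pointwise limits on the whole space are used rather than almost everywhere limits: every class
  modulo almost everywhere equality has such a representative, and \<open>\<parallel>f\<parallel>\<close> and the zero set of
  \<open>f\<close> are then measurable even if the measure is not complete.
\<close>

definition strongly_measurable :: "'a measure \<Rightarrow> ('a \<Rightarrow> 'b::banach) \<Rightarrow> bool" where
  "strongly_measurable M f \<longleftrightarrow>
     (\<exists>\<sigma>. (\<forall>n::nat. simple_function M (\<sigma> n)) \<and> (\<forall>s\<in>space M. (\<lambda>n. \<sigma> n s) \<longlonglongrightarrow> f s))"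

definition L1 :: "'a measure \<Rightarrow> ('a \<Rightarrow> 'b::banach) set" where
  "L1 M = {f. strongly_measurable M f \<and> integrable M (\<lambda>s. norm (f s))}"

definition L1_norm :: "'a measure \<Rightarrow> ('a \<Rightarrow> 'b::banach) \<Rightarrow> real" where
  "L1_norm M f = (LINT s|M. norm (f s))"

text \<open>
  The last conjunct says that \<open>G\<close> is a union of classes modulo almost everywhere equality, so
  that these sets correspond exactly to the linear subspaces of the quotient space.
\<close>

definition L1_subspace :: "'a measure \<Rightarrow> ('a \<Rightarrow> 'b::banach) set \<Rightarrow> bool" where
  "L1_subspace M G \<longleftrightarrow>
     G \<subseteq> L1 M \<and>
     (\<lambda>s. 0) \<in> G \<and>
     (\<forall>g\<in>G. \<forall>h\<in>G. (\<lambda>s. g s + h s) \<in> G) \<and>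
     (\<forall>c::real. \<forall>g\<in>G. (\<lambda>s. c *\<^sub>R g s) \<in> G) \<and>
     (\<forall>g\<in>G. \<forall>h\<in>L1 M. (AE s in M. g s = h s) \<longrightarrow> h \<in> G)"

definition L1_closure :: "'a measure \<Rightarrow> ('a \<Rightarrow> 'b::banach) set \<Rightarrow> ('a \<Rightarrow> 'b) set" where
  "L1_closure M G = {f \<in> L1 M. \<forall>e>0. \<exists>g\<in>G. L1_norm M (\<lambda>s. f s - g s) < e}"

definition best_approximants ::
    "'a measure \<Rightarrow> ('a \<Rightarrow> 'b::banach) set \<Rightarrow> ('a \<Rightarrow> 'b) \<Rightarrow> ('a \<Rightarrow> 'b) set" where
  "best_approximants M G f =
     {g\<^sub>0 \<in> G. L1_norm M (\<lambda>s. f s - g\<^sub>0 s) = (INF g\<in>G. L1_norm M (\<lambda>s. f s - g s))}"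

definition zero_set :: "'a measure \<Rightarrow> ('a \<Rightarrow> 'b::banach) \<Rightarrow> 'a set" where
  "zero_set M h = {s \<in> space M. h s = 0}"

definition Frechet_differentiable_norm :: "'b::banach itself \<Rightarrow> bool" where
  "Frechet_differentiable_norm _ \<longleftrightarrow> (\<forall>x::'b. x \<noteq> 0 \<longrightarrow> norm differentiable (at x))"

definition is_support_map :: "'b::banach \<Rightarrow> ('b \<Rightarrow>\<^sub>L real) \<Rightarrow> bool" where
  "is_support_map x \<phi> \<longleftrightarrow> norm \<phi> = 1 \<and> blinfun_apply \<phi> x = norm x"

text \<open>
  Only meaningful for \<open>x \<noteq> 0\<close> and when the support map at \<open>x\<close> is unique, as is the case for a
  Frechet differentiable norm.
\<close>

definition support_map :: "'b::banach \<Rightarrow> ('b \<Rightarrow>\<^sub>L real)" where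
  "support_map x = (THE \<phi>. is_support_map x \<phi>)"

end

theory Submission
  imports Defs
begin

text \<open>
  Put \<open>h = f - g\<^sub>0\<close>. The difference quotients \<open>(\<parallel>h(s) + t g(s)\<parallel> - \<parallel>h(s)\<parallel>) / t\<close> are
  dominated by \<open>\<parallel>g(s)\<parallel>\<close> and tend, as \<open>t\<close> decreases to 0, to \<open>F\<^bsub>h(s)\<^esub>(g(s))\<close> off the zero set
  of \<open>h\<close> and to \<open>\<parallel>g(s)\<parallel>\<close> on it. By dominated convergence the one-sided derivative of the
  \<open>L\<^sup>1\<close> norm at \<open>h\<close> in direction \<open>g\<close> is the integral of this limit, and it is nonnegative
  for all \<open>\<plusminus> g\<close> if \<open>g\<^sub>0\<close> is a best approximant. Conversely, \<open>F\<^bsub>x\<^esub>(x + y) \<le> \<parallel>x + y\<parallel>\<close> shows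
  that the limit is at most \<open>\<parallel>h + g\<parallel> - \<parallel>h\<parallel>\<close> pointwise.
\<close>

section \<open>Difference quotients of the norm and the support map\<close>

definition norm_quotient :: "nat \<Rightarrow> 'b::real_normed_vector \<Rightarrow> 'b \<Rightarrow> real" where
  "norm_quotient n x y = (norm (x + inverse (real (Suc n)) *\<^sub>R y) - norm x) / inverse (real (Suc n))"

text \<open>Reverse triangle inequality. Since the bound is free of \<open>n\<close> and
  \<open>x\<close>, it serves both as the integrable majorant and as the estimate that gives the
  derivative norm at most 1.\<close>

lemma abs_norm_quotient_le: "\<bar>norm_quotient n x y\<bar> \<le> norm y"
proof -
  define t where "t = inverse (real (Suc n))"
  have "t > 0"
    by (simp add: t_def)
  moreover have "\<bar>norm (x + t *\<^sub>R y) - norm x\<bar> \<le> norm y * t"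
    using norm_triangle_ineq3[of "x + t *\<^sub>R y" x] \<open>t > 0\<close> by (simp add: mult.commute)
  ultimately show ?thesis
    unfolding norm_quotient_def t_def[symmetric] by (simp add: pos_divide_le_eq)
qed

text \<open>On the line through \<open>x\<close> in direction \<open>y\<close> the chain rule leaves
  a one-variable derivative. The increments are taken along the sequence 1/(n+1) because dominated
  convergence is applied to sequences later.\<close>

lemma norm_quotient_tendsto_derivative:
  assumes "(norm has_derivative D) (at x)"
  shows "(\<lambda>n. norm_quotient n x y) \<longlonglongrightarrow> D y"
proof -
  interpret D: bounded_linear D
    using assms by (rule has_derivative_bounded_linear)
  have "((\<lambda>t::real. norm (x + t *\<^sub>R y)) has_derivative (\<lambda>t. D (t *\<^sub>R y))) (at 0)"
    by (rule has_derivative_compose[where f = "\<lambda>t. x + t *\<^sub>R y" and g = norm])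
       (auto intro!: derivative_eq_intros simp: assms)
  then have "((\<lambda>t::real. norm (x + t *\<^sub>R y)) has_real_derivative D y) (at 0)"
    by (simp add: has_field_derivative_def D.scaleR mult_commute_abs)
  then have "(\<lambda>t::real. (norm (x + t *\<^sub>R y) - norm x) / t) \<midarrow>0\<rightarrow> D y"
    by (simp add: DERIV_def)
  then show ?thesis
    unfolding norm_quotient_def
    using LIMSEQ_inverse_real_of_nat by (force simp: LIMSEQ_SEQ_conv[symmetric])
qed

text \<open>The derivative of the norm at \<open>x\<close> is itself a support map, and it is the
  only one, so the description in \<open>support_map\<close> denotes it.\<close>

lemma is_support_map_support_map:
  fixes x :: "'b::banach"
  assumes "norm differentiable (at x)" "x \<noteq> 0"
  shows "is_support_map x (support_map x)"
    and norm_quotient_tendsto_support_map: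
      "(\<lambda>n. norm_quotient n x y) \<longlonglongrightarrow> blinfun_apply (support_map x) y"
proof -
  obtain D where D: "(norm has_derivative D) (at x)"
    using assms by (auto simp: differentiable_def)
  define \<phi> where "\<phi> = Blinfun D"
  have lim: "(\<lambda>n. norm_quotient n x y) \<longlonglongrightarrow> blinfun_apply \<phi> y" for y
    using norm_quotient_tendsto_derivative[OF D] has_derivative_bounded_linear[OF D]
    by (simp add: \<phi>_def bounded_linear_Blinfun_apply)
  have le: "norm (blinfun_apply \<phi> y) \<le> norm y" for y
    by (rule tendsto_upperbound[OF tendsto_norm[OF lim]])
       (auto simp: abs_norm_quotient_le)
  have x: "blinfun_apply \<phi> x = norm x"
  proof -
    \<comment> \<open>In direction \<open>x\<close> the norm grows linearly by homogeneity, so the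
      quotients are constant.\<close>
    have "norm_quotient n x x = norm x" for n
    proof -
      have "x + inverse (real (Suc n)) *\<^sub>R x = (1 + inverse (real (Suc n))) *\<^sub>R x"
        by (simp add: scaleR_add_left)
      then have "norm (x + inverse (real (Suc n)) *\<^sub>R x) = (1 + inverse (real (Suc n))) * norm x"
        by (simp only: norm_scaleR) (simp add: add_nonneg_nonneg)
      then show ?thesis
        by (simp add: norm_quotient_def algebra_simps)
    qed
    then show ?thesis
      using lim[of x] by (simp add: LIMSEQ_const_iff)
  qed
  have "norm \<phi> \<le> 1"
    by (rule norm_blinfun_bound) (use le in auto)
  moreover have "norm x \<le> norm \<phi> * norm x"
    using norm_blinfun[of \<phi> x] x by simp
  ultimately have \<phi>: "is_support_map x \<phi>"
    using \<open>x \<noteq> 0\<close> x by (auto simp: is_support_map_def)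
  have unique: "\<psi> = \<phi>" if \<psi>: "is_support_map x \<psi>" for \<psi>
  proof (rule blinfun_eqI)
    have \<psi>_le: "blinfun_apply \<psi> z \<le> norm z" for z
      using norm_blinfun[of \<psi> z] \<psi> by (auto simp: is_support_map_def)
    \<comment> \<open>Evaluating \<psi> at x + t y, where it is at most the norm, and using
      \<psi>(x) = norm x bounds \<psi>(y) by each quotient. Two linear functionals ordered in this
      way agree: replace y by -y.\<close>
    have le: "blinfun_apply \<psi> y \<le> blinfun_apply \<phi> y" for y
    proof (rule tendsto_lowerbound[OF lim])
      have "blinfun_apply \<psi> y \<le> norm_quotient n x y" for n
      proof -
        define t where "t = inverse (real (Suc n))"
        have "t > 0"
          by (simp add: t_def)
        moreover have "norm x + blinfun_apply \<psi> y * t \<le> norm (x + t *\<^sub>R y)"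
          using \<psi>_le[of "x + t *\<^sub>R y"] \<psi>
          by (simp add: is_support_map_def blinfun.add_right blinfun.scaleR_right mult.commute)
        ultimately show ?thesis
          unfolding norm_quotient_def t_def[symmetric] by (simp add: pos_le_divide_eq)
      qed
      then show "\<forall>\<^sub>F n in sequentially. blinfun_apply \<psi> y \<le> norm_quotient n x y"
        by simp
    qed simp
    show "blinfun_apply \<psi> y = blinfun_apply \<phi> y" for y
      using le[of y] le[of "- y"] by (simp add: blinfun.minus_right)
  qed
  have eq: "support_map x = \<phi>"
    unfolding support_map_def using \<phi> unique by (rule the_equality)
  show "is_support_map x (support_map x)"
    using \<phi> eq by simp
  show "(\<lambda>n. norm_quotient n x y) \<longlonglongrightarrow> blinfun_apply (support_map x) y"
    using lim eq by simp
qed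

lemma support_map_add_le:
  fixes x y :: "'b::banach"
  assumes "norm differentiable (at x)" "x \<noteq> 0"
  shows "norm x + blinfun_apply (support_map x) y \<le> norm (x + y)"
  using is_support_map_support_map[OF assms] norm_blinfun[of "support_map x" "x + y"]
  by (auto simp: is_support_map_def blinfun.add_right)

section \<open>Linear combinations and zero sets in the Lebesgue-Bochner space\<close>

lemma L1_add_scaleR:
  fixes f g :: "'a \<Rightarrow> 'b::banach"
  assumes "f \<in> L1 M" "g \<in> L1 M"
  shows "(\<lambda>s. f s + c *\<^sub>R g s) \<in> L1 M"
proof -
  obtain \<sigma> \<tau> where \<sigma>: "\<And>n::nat. simple_function M (\<sigma> n)" "\<And>s. s \<in> space M \<Longrightarrow> (\<lambda>n. \<sigma> n s) \<longlonglongrightarrow> f s"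
    and \<tau>: "\<And>n::nat. simple_function M (\<tau> n)" "\<And>s. s \<in> space M \<Longrightarrow> (\<lambda>n. \<tau> n s) \<longlonglongrightarrow> g s"
    using assms unfolding L1_def strongly_measurable_def by blast
  have simple: "simple_function M (\<lambda>s. \<sigma> n s + c *\<^sub>R \<tau> n s)" for n
    by (rule simple_function_compose2[OF \<sigma>(1) \<tau>(1)])
  have lim: "(\<lambda>n. \<sigma> n s + c *\<^sub>R \<tau> n s) \<longlonglongrightarrow> f s + c *\<^sub>R g s" if "s \<in> space M" for s
    by (intro tendsto_intros \<sigma> \<tau> that)
  \<comment> \<open>As the codomain need not be separable, measurability of the norm is read off the
    real-valued norms of the approximating simple functions.\<close>
  have "(\<lambda>s. norm (f s + c *\<^sub>R g s)) \<in> borel_measurable M"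
  proof (rule borel_measurable_LIMSEQ_real)
    show "(\<lambda>n. norm (\<sigma> n s + c *\<^sub>R \<tau> n s)) \<longlonglongrightarrow> norm (f s + c *\<^sub>R g s)" if "s \<in> space M" for s
      by (rule tendsto_norm[OF lim[OF that]])
    show "(\<lambda>s. norm (\<sigma> n s + c *\<^sub>R \<tau> n s)) \<in> borel_measurable M" for n
      by (rule borel_measurable_simple_function[OF simple_function_compose1[OF simple]])
  qed
  moreover have "AE s in M. norm (norm (f s + c *\<^sub>R g s)) \<le> norm (norm (f s) + \<bar>c\<bar> * norm (g s))"
    by (auto intro!: AE_I2 order_trans[OF norm_triangle_ineq])
  moreover have "integrable M (\<lambda>s. norm (f s) + \<bar>c\<bar> * norm (g s))"
    using assms by (auto simp: L1_def)
  ultimately have "integrable M (\<lambda>s. norm (f s + c *\<^sub>R g s))"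
    by (rule Bochner_Integration.integrable_bound[rotated])
  moreover have "strongly_measurable M (\<lambda>s. f s + c *\<^sub>R g s)"
    unfolding strongly_measurable_def using simple lim
    by (intro exI[of _ "\<lambda>n s. \<sigma> n s + c *\<^sub>R \<tau> n s"]) auto
  ultimately show ?thesis
    by (simp add: L1_def)
qed

lemma zero_set_in_sets:
  assumes "h \<in> L1 M"
  shows "zero_set M h \<in> sets M"
proof -
  have [measurable]: "(\<lambda>s. norm (h s)) \<in> borel_measurable M"
    using assms by (auto simp: L1_def)
  have "zero_set M h = {s \<in> space M. norm (h s) = 0}"
    by (simp add: zero_set_def)
  also have "\<dots> \<in> sets M"
    by measurable
  finally show ?thesis .
qed

section \<open>The one-sided derivative of the \<open>L1_norm\<close>\<close>

lemma integral_norm_quotient: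
  assumes "h \<in> L1 M" "g \<in> L1 M"
  shows "integrable M (\<lambda>s. norm_quotient n (h s) (g s))"
    and "(LINT s|M. norm_quotient n (h s) (g s)) =
      (L1_norm M (\<lambda>s. h s + inverse (real (Suc n)) *\<^sub>R g s) - L1_norm M h) / inverse (real (Suc n))"
proof -
  have "integrable M (\<lambda>s. norm (h s))"
    and "integrable M (\<lambda>s. norm (h s + inverse (real (Suc n)) *\<^sub>R g s))"
    using assms L1_add_scaleR[OF assms, of "inverse (real (Suc n))"] by (simp_all only: L1_def mem_Collect_eq)
  then show "integrable M (\<lambda>s. norm_quotient n (h s) (g s))"
    and "(LINT s|M. norm_quotient n (h s) (g s)) =
      (L1_norm M (\<lambda>s. h s + inverse (real (Suc n)) *\<^sub>R g s) - L1_norm M h) / inverse (real (Suc n))"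
    unfolding norm_quotient_def L1_norm_def by (simp_all del: inverse_eq_divide of_nat_Suc)
qed

definition L1_directional ::
    "'a measure \<Rightarrow> ('a \<Rightarrow> 'b::banach) \<Rightarrow> ('a \<Rightarrow> 'b) \<Rightarrow> real" where
  "L1_directional M h g =
    (LINT s:(space M - zero_set M h)|M. blinfun_apply (support_map (h s)) (g s)) +
    (LINT s:zero_set M h|M. norm (g s))"

text \<open>The integral off the zero set is odd in \<open>g\<close> and the one on it is even, so
  the two signs of \<open>g\<close> yield the two halves of the absolute value bound.\<close>

lemma L1_directional_uminus_le:
  "0 \<le> L1_directional M h g \<and> 0 \<le> L1_directional M h (\<lambda>s. - g s) \<longleftrightarrow>
    \<bar>LINT s:(space M - zero_set M h)|M. blinfun_apply (support_map (h s)) (g s)\<bar>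
      \<le> (LINT s:zero_set M h|M. norm (g s))"
  by (auto simp: L1_directional_def blinfun.minus_right set_lebesgue_integral_def abs_le_iff)

lemma
  fixes h g :: "'a \<Rightarrow> 'b::banach"
  assumes "Frechet_differentiable_norm TYPE('b)" and h: "h \<in> L1 M" and g: "g \<in> L1 M"
  shows L1_norm_quotient_tendsto: "(\<lambda>n. (L1_norm M (\<lambda>s. h s + inverse (real (Suc n)) *\<^sub>R g s)
        - L1_norm M h) / inverse (real (Suc n))) \<longlonglongrightarrow> L1_directional M h g"
    and L1_directional_le: "L1_norm M h + L1_directional M h g \<le> L1_norm M (\<lambda>s. h s + g s)"
proof -
  define \<Phi> where "\<Phi> = (\<lambda>s. indicator (space M - zero_set M h) s *\<^sub>R blinfun_apply (support_map (h s)) (g s)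
      + indicator (zero_set M h) s *\<^sub>R norm (g s))"
  have diff: "norm differentiable (at x)" if "x \<noteq> 0" for x :: 'b
    using assms(1) that by (auto simp: Frechet_differentiable_norm_def)
  have lim: "(\<lambda>n. norm_quotient n (h s) (g s)) \<longlonglongrightarrow> \<Phi> s" if "s \<in> space M" for s
  proof (cases "h s = 0")
    case True
    then show ?thesis
      using that by (simp add: \<Phi>_def zero_set_def norm_quotient_def)
  next
    case False
    then show ?thesis
      using that norm_quotient_tendsto_support_map[OF diff] by (simp add: \<Phi>_def zero_set_def)
  qed
  have meas: "(\<lambda>s. norm_quotient n (h s) (g s)) \<in> borel_measurable M" for n
    using integral_norm_quotient(1)[OF h g] by auto
  \<comment> \<open>No measurability of x \<mapsto> \<open>support_map x\<close> is needed: \<Phi>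
    is a pointwise limit of measurable quotients.\<close>
  have \<Phi>_meas [measurable]: "\<Phi> \<in> borel_measurable M"
    by (rule borel_measurable_LIMSEQ_real[OF lim meas])
  have g_int: "integrable M (\<lambda>s. norm (g s))"
    using g by (simp add: L1_def)
  note [measurable] = zero_set_in_sets[OF h]
  have "AE s in M. norm (norm_quotient n (h s) (g s)) \<le> norm (g s)" for n
    by (simp add: abs_norm_quotient_le)
  note dominated = \<Phi>_meas meas g_int AE_I2[OF lim] this
  have \<Phi>_int: "integrable M \<Phi>"
    by (rule integrable_dominated_convergence[OF dominated])
  have conv: "(\<lambda>n. LINT s|M. norm_quotient n (h s) (g s)) \<longlonglongrightarrow> integral\<^sup>L M \<Phi>"
    by (rule integral_dominated_convergence[OF dominated])
  have zero_int: "integrable M (\<lambda>s. indicator (zero_set M h) s *\<^sub>R norm (g s))"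
    by (rule integrable_mult_indicator[OF _ g_int]) measurable
  \<comment> \<open>The integral of \<Phi> splits only if both summands are integrable. The support
    map term is recovered as \<Phi> minus the other one.\<close>
  have "integrable M (\<lambda>s. \<Phi> s - indicator (zero_set M h) s *\<^sub>R norm (g s))"
    by (intro Bochner_Integration.integrable_diff \<Phi>_int zero_int)
  then have directional: "integral\<^sup>L M \<Phi> = L1_directional M h g"
    using zero_int by (simp add: \<Phi>_def L1_directional_def set_lebesgue_integral_def)
  show "(\<lambda>n. (L1_norm M (\<lambda>s. h s + inverse (real (Suc n)) *\<^sub>R g s)
        - L1_norm M h) / inverse (real (Suc n))) \<longlonglongrightarrow> L1_directional M h g"
    using conv unfolding directional integral_norm_quotient(2)[OF h g] .
  have h_int: "integrable M (\<lambda>s. norm (h s))"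
    using h by (simp add: L1_def)
  have "(LINT s|M. norm (h s) + \<Phi> s) \<le> (LINT s|M. norm (h s + g s))"
  proof (rule integral_mono)
    show "integrable M (\<lambda>s. norm (h s) + \<Phi> s)"
      using h_int \<Phi>_int by simp
    show "integrable M (\<lambda>s. norm (h s + g s))"
      using L1_add_scaleR[OF h g, of 1] by (simp add: L1_def)
    \<comment> \<open>On the zero set of \<open>h\<close> both sides equal
      \<open>norm (g s)\<close>; off it this is \<open>support_map_add_le\<close>.\<close>
    show "norm (h s) + \<Phi> s \<le> norm (h s + g s)" if "s \<in> space M" for s
      using support_map_add_le[OF diff, of "h s" "g s"] that
      by (cases "h s = 0") (auto simp: \<Phi>_def zero_set_def)
  qed
  then show "L1_norm M h + L1_directional M h g \<le> L1_norm M (\<lambda>s. h s + g s)"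
    using h_int \<Phi>_int by (simp add: L1_norm_def directional)
qed

section \<open>Best approximation as minimality at \<open>h\<close> over translates by
  \<open>G\<close>\<close>

lemma best_approximants_iff:
  assumes G: "L1_subspace M G" and g\<^sub>0: "g\<^sub>0 \<in> G"
  shows "g\<^sub>0 \<in> best_approximants M G f \<longleftrightarrow>
    (\<forall>g\<in>G. L1_norm M (\<lambda>s. f s - g\<^sub>0 s) \<le> L1_norm M (\<lambda>s. f s - g\<^sub>0 s + g s))"
    (is "_ \<longleftrightarrow> (\<forall>g\<in>G. ?m \<le> ?N g)")
proof -
  have add: "(\<lambda>s. g s + c *\<^sub>R k s) \<in> G" if "g \<in> G" "k \<in> G" for g k c
    using G that by (auto simp: L1_subspace_def)
  have bdd: "bdd_below ((\<lambda>g. L1_norm M (\<lambda>s. f s - g s)) ` G)"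
    by (rule bdd_belowI[of _ 0]) (auto simp: L1_norm_def)
  have "g\<^sub>0 \<in> best_approximants M G f \<longleftrightarrow> (\<forall>g\<in>G. ?m \<le> L1_norm M (\<lambda>s. f s - g s))"
  proof
    assume "g\<^sub>0 \<in> best_approximants M G f"
    then show "\<forall>g\<in>G. ?m \<le> L1_norm M (\<lambda>s. f s - g s)"
      using bdd by (auto simp: best_approximants_def intro!: cINF_lower)
  next
    assume *: "\<forall>g\<in>G. ?m \<le> L1_norm M (\<lambda>s. f s - g s)"
    then have "(INF g\<in>G. L1_norm M (\<lambda>s. f s - g s)) = ?m"
      using g\<^sub>0 by (intro cInf_eq_minimum) auto
    then show "g\<^sub>0 \<in> best_approximants M G f"
      using g\<^sub>0 by (simp add: best_approximants_def)
  qed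
  also have "\<dots> \<longleftrightarrow> (\<forall>g\<in>G. ?m \<le> ?N g)"
  \<comment> \<open>Both directions substitute \<open>g\<^sub>0 - g\<close> for \<open>g\<close>, an
    involution of \<open>G\<close> that exchanges f - g with f - \<open>g\<^sub>0\<close> +
    g.\<close>
  proof safe
    fix g assume *: "\<forall>g\<in>G. ?m \<le> L1_norm M (\<lambda>s. f s - g s)" and "g \<in> G"
    then show "?m \<le> ?N g"
      using bspec[OF *, OF add[OF g\<^sub>0 \<open>g \<in> G\<close>, of "- 1"]] by (simp add: algebra_simps)
  next
    fix g assume *: "\<forall>g\<in>G. ?m \<le> ?N g" and "g \<in> G"
    then show "?m \<le> L1_norm M (\<lambda>s. f s - g s)"
      using bspec[OF *, OF add[OF g\<^sub>0 \<open>g \<in> G\<close>, of "- 1"]] by (simp add: algebra_simps)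
  qed
  finally show ?thesis .
qed

theorem theorem3p3:
  fixes M :: "'a measure" and G :: "('a \<Rightarrow> 'b::banach) set" and f g\<^sub>0 :: "'a \<Rightarrow> 'b"
  assumes "Frechet_differentiable_norm TYPE('b)"
    and "L1_subspace M G"
    and "f \<in> L1 M - L1_closure M G"
    and "g\<^sub>0 \<in> G"
  shows "g\<^sub>0 \<in> best_approximants M G f \<longleftrightarrow>
    (\<forall>g\<in>G.
      \<bar>LINT s:(space M - zero_set M (\<lambda>s. f s - g\<^sub>0 s))|M.
          blinfun_apply (support_map (f s - g\<^sub>0 s)) (g s)\<bar>
      \<le> (LINT s:zero_set M (\<lambda>s. f s - g\<^sub>0 s)|M. norm (g s)))"
proof -
  define h where "h = (\<lambda>s. f s - g\<^sub>0 s)"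
  have scale: "(\<lambda>s. c *\<^sub>R g s) \<in> G" if "g \<in> G" for c g
    using assms(2) that by (auto simp: L1_subspace_def)
  have uminus: "(\<lambda>s. - g s) \<in> G" if "g \<in> G" for g
    using scale[OF that, of "- 1"] by simp
  have L1: "g \<in> L1 M" if "g \<in> G" for g
    using assms(2) that by (auto simp: L1_subspace_def)
  have h: "h \<in> L1 M"
    using L1_add_scaleR[of f M g\<^sub>0 "- 1"] assms(3) L1[OF assms(4)] by (simp add: h_def)
  have "(\<forall>g\<in>G. L1_norm M h \<le> L1_norm M (\<lambda>s. h s + g s)) \<longleftrightarrow> (\<forall>g\<in>G. 0 \<le> L1_directional M h g)"
  proof safe
    fix g assume min: "\<forall>g\<in>G. L1_norm M h \<le> L1_norm M (\<lambda>s. h s + g s)" and "g \<in> G"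
    show "0 \<le> L1_directional M h g"
      \<comment> \<open>\<open>G\<close> contains all positive multiples of \<open>g\<close>, so
        minimality makes every quotient nonnegative, hence also the limit.\<close>
      by (rule tendsto_lowerbound[OF L1_norm_quotient_tendsto[OF assms(1) h L1[OF \<open>g \<in> G\<close>]]])
         (use bspec[OF min, OF scale[OF \<open>g \<in> G\<close>]] in \<open>auto intro!: always_eventually\<close>)
  next
    fix g assume "\<forall>g\<in>G. 0 \<le> L1_directional M h g" and "g \<in> G"
    then show "L1_norm M h \<le> L1_norm M (\<lambda>s. h s + g s)"
      using L1_directional_le[OF assms(1) h L1[OF \<open>g \<in> G\<close>]] by force
  qed
  also have "\<dots> \<longleftrightarrow> (\<forall>g\<in>G. 0 \<le> L1_directional M h g \<and> 0 \<le> L1_directional M h (\<lambda>s. - g s))"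
    using uminus by blast
  finally show ?thesis
    unfolding best_approximants_iff[OF assms(2,4)] L1_directional_uminus_le h_def .
qed

end
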